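(* Let $\mathcal O$ be an ordered set and let $\psi:\mathrm{OP}(\mathcal O,\mathbb R)\rightharpoonup\mathbb R$ be a partial function such that (1) $\psi$ is encompassing; (2) $\mathrm{dom}(\psi)$ is an $\mathbb R$-linear subspace of $\mathrm{OP}(\mathcal O,\mathbb R)$; (3) $\psi$ is an $\mathbb R$-linear transformation. Then for every $f_1,f_2\in\mathrm{OP}(\mathcal O,\mathbb R)$ and for every non-negative $a_1,a_2\in\mathbb R$ \[ \mathrm{uex}_\psi(a_1f_1+a_2f_2)\le a_1\,\mathrm{uex}_\psi(f_1)+a_2\,\mathrm{uex}_\psi(f_2) \] and similarly \[ a_1\,\mathrm{lex}_\psi(f_1)+a_2\,\mathrm{lex}_\psi(f_2)\le\mathrm{lex}_\psi(a_1f_1+a_2f_2). \] Moreover \[ -\mathrm{lex}_\psi(f)=\mathrm{uex}_\psi(-f) \] for every $f\in\mathrm{OP}(\mathcal O,\mathbb R)$. In particular, $\mathrm{Dar}(\psi)$ is an $\mathbb R$-linear subspace of $\mathrm{OP}(\mathcal O,\mathbb R)$ and $\mathrm{ex}_\psi$ is $\mathbb R$-linear.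
   Context: An ordered set is a set with a reflexive, antisymmetric and transitive relation $\le$. For an ordered set $\mathcal O$, $\mathrm{OP}(\mathcal O,\mathbb R)$ is the set of order preserving functions $\mathcal O\to\mathbb R$, ordered by $f\le g$ if and only if $f(x)\le g(x)$ for all $x\in\mathcal O$. The paper regards $\mathrm{OP}(\mathcal O,\mathbb R)$, for each ordered set $\mathcal O$, as an $\mathbb R$-algebra with operations defined pointwise on $\mathcal O$; sums, scalar multiples and negatives of functions are understood in this sense. A partial function $\psi:\mathcal A\rightharpoonup\mathcal P$ between ordered sets is an order preserving function $\psi:\mathrm{dom}(\psi)\to\mathcal P$ defined on a subset $\mathrm{dom}(\psi)\subseteq\mathcal A$ with the induced order. It is encompassing if for every $x\in\mathcal A$ there exist $y,z\in\mathrm{dom}(\psi)$ with $y\le x\le z$. An extension of $\psi$ to $\mathcal A$ is an order preserving function $f:\mathcal A\to\mathcal P$ whose restriction to $\mathrm{dom}(\psi)$ is $\psi$. $\psi$ is extremizable if there exist extensions $\mathrm{lex}_\psi,\mathrm{uex}_\psi:\mathcal A\to\mathcal P$ of $\psi$ (the lower and upper extensions) with $\mathrm{lex}_\psi\le f\le\mathrm{uex}_\psi$ pointwise for every extension $f$ of $\psi$ to $\mathcal A$. In that case $\mathrm{Dar}(\psi)=\{x\in\mathcal A\mid\mathrm{lex}_\psi(x)=\mathrm{uex}_\psi(x)\}$ and $\mathrm{ex}_\psi$ is the common restriction of $\mathrm{lex}_\psi$ and $\mathrm{uex}_\psi$ to $\mathrm{Dar}(\psi)$. Every encompassing partial function with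 codomain $\mathbb R$ is extremizable.
   Formalization: Since OP(O,R) need not be closed under negation, −lex(f)=uex(−f) is claimed only when −f is order preserving, and Dar(ψ) is claimed closed (and ex_ψ linear) only for those real linear combinations that are order preserving. *)

theory Defs
  imports Complex_Main "HOL-Library.FuncSet" "HOL-Library.Function_Algebras"
begin

section \<open>Partial functions between ordered sets and their extensions\<close>

text \<open>
  An ordered set is a set \<open>A\<close> in a type of class \<open>order\<close>, with the induced order. A partial function
  from \<open>A\<close> to the ordered type \<open>'c\<close> is a map \<open>\<psi>\<close> whose domain is the set \<open>dom \<psi>\<close>.
\<close>

definition partial_fun :: "'b::order set \<Rightarrow> ('b \<rightharpoonup> 'c::order) \<Rightarrow> bool" where
  "partial_fun A \<psi> \<longleftrightarrow> dom \<psi> \<subseteq> A \<and> mono_on (dom \<psi>) (\<lambda>x. the (\<psi> x))"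

definition encompassing :: "'b::order set \<Rightarrow> ('b \<rightharpoonup> 'c::order) \<Rightarrow> bool" where
  "encompassing A \<psi> \<longleftrightarrow> (\<forall>x\<in>A. \<exists>y\<in>dom \<psi>. \<exists>z\<in>dom \<psi>. y \<le> x \<and> x \<le> z)"

text \<open>Total functions on \<open>A\<close> are taken in \<open>extensional A\<close>, so that they are determined by their
  values on \<open>A\<close>.\<close>

definition is_extension :: "'b::order set \<Rightarrow> ('b \<rightharpoonup> 'c::order) \<Rightarrow> ('b \<Rightarrow> 'c) \<Rightarrow> bool" where
  "is_extension A \<psi> f \<longleftrightarrow>
     f \<in> extensional A \<and> mono_on A f \<and> (\<forall>x\<in>dom \<psi>. f x = the (\<psi> x))"

definition is_lower_extension :: "'b::order set \<Rightarrow> ('b \<rightharpoonup> 'c::order) \<Rightarrow> ('b \<Rightarrow> 'c) \<Rightarrow> bool" where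
  "is_lower_extension A \<psi> l \<longleftrightarrow>
     is_extension A \<psi> l \<and> (\<forall>f. is_extension A \<psi> f \<longrightarrow> (\<forall>x\<in>A. l x \<le> f x))"

definition is_upper_extension :: "'b::order set \<Rightarrow> ('b \<rightharpoonup> 'c::order) \<Rightarrow> ('b \<Rightarrow> 'c) \<Rightarrow> bool" where
  "is_upper_extension A \<psi> u \<longleftrightarrow>
     is_extension A \<psi> u \<and> (\<forall>f. is_extension A \<psi> f \<longrightarrow> (\<forall>x\<in>A. f x \<le> u x))"

definition extremizable :: "'b::order set \<Rightarrow> ('b \<rightharpoonup> 'c::order) \<Rightarrow> bool" where
  "extremizable A \<psi> \<longleftrightarrow> (\<exists>l. is_lower_extension A \<psi> l) \<and> (\<exists>u. is_upper_extension A \<psi> u)"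

text \<open>\<open>lex\<close>, \<open>uex\<close>, \<open>Dar\<close> and \<open>ex\<close> are meaningful for extremizable \<open>\<psi>\<close> only; uniqueness is
  shown below, as is existence for encompassing real-valued \<open>\<psi>\<close>. (The name \<open>lex\<close> itself is
  taken by the list library.)\<close>

definition lex_ext :: "'b::order set \<Rightarrow> ('b \<rightharpoonup> 'c::order) \<Rightarrow> 'b \<Rightarrow> 'c" where
  "lex_ext A \<psi> = (THE l. is_lower_extension A \<psi> l)"

definition uex_ext :: "'b::order set \<Rightarrow> ('b \<rightharpoonup> 'c::order) \<Rightarrow> 'b \<Rightarrow> 'c" where
  "uex_ext A \<psi> = (THE u. is_upper_extension A \<psi> u)"

definition Dar :: "'b::order set \<Rightarrow> ('b \<rightharpoonup> 'c::order) \<Rightarrow> 'b set" where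
  "Dar A \<psi> = {x \<in> A. lex_ext A \<psi> x = uex_ext A \<psi> x}"

definition Dar_ext :: "'b::order set \<Rightarrow> ('b \<rightharpoonup> 'c::order) \<Rightarrow> ('b \<rightharpoonup> 'c)" where
  "Dar_ext A \<psi> = (\<lambda>x. if x \<in> Dar A \<psi> then Some (lex_ext A \<psi> x) else None)"

lemma dom_Dar_ext: "dom (Dar_ext A \<psi>) = Dar A \<psi>"
  by (auto simp: Dar_ext_def split: if_splits)

lemma lower_extension_unique:
  assumes "is_lower_extension A \<psi> l" "is_lower_extension A \<psi> l'"
  shows "l = l'"
  using assms unfolding is_lower_extension_def is_extension_def
  by (intro extensionalityI[of _ A]) (auto intro: order_antisym)

lemma upper_extension_unique:
  assumes "is_upper_extension A \<psi> u" "is_upper_extension A \<psi> u'"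
  shows "u = u'"
  using assms unfolding is_upper_extension_def is_extension_def
  by (intro extensionalityI[of _ A]) (auto intro: order_antisym)

lemma extremizableD:
  assumes "extremizable A \<psi>"
  shows "is_lower_extension A \<psi> (lex_ext A \<psi>)" "is_upper_extension A \<psi> (uex_ext A \<psi>)"
proof -
  obtain l u where l: "is_lower_extension A \<psi> l" and u: "is_upper_extension A \<psi> u"
    using assms by (auto simp: extremizable_def)
  show "is_lower_extension A \<psi> (lex_ext A \<psi>)"
    unfolding lex_ext_def
    by (rule theI[where P = "is_lower_extension A \<psi>"]) (fact l, rule lower_extension_unique[OF _ l])
  show "is_upper_extension A \<psi> (uex_ext A \<psi>)"
    unfolding uex_ext_def
    by (rule theI[where P = "is_upper_extension A \<psi>"]) (fact u, rule upper_extension_unique[OF _ u])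
qed

lemma encompassing_real_extremizable:
  fixes \<psi> :: "'b::order \<rightharpoonup> real"
  assumes \<psi>: "partial_fun A \<psi>" and enc: "encompassing A \<psi>"
  shows "extremizable A \<psi>"
proof -
  let ?v = "\<lambda>x. the (\<psi> x)"
  let ?L = "\<lambda>x. ?v ` {y \<in> dom \<psi>. y \<le> x}"
  let ?U = "\<lambda>x. ?v ` {y \<in> dom \<psi>. x \<le> y}"
  let ?l = "restrict (\<lambda>x. Sup (?L x)) A"
  let ?u = "restrict (\<lambda>x. Inf (?U x)) A"
  have mono: "?v x \<le> ?v y" if "x \<in> dom \<psi>" "y \<in> dom \<psi>" "x \<le> y" for x y
    using \<psi> that unfolding partial_fun_def by (meson monotone_onD)
  have sub: "x \<in> A" if "x \<in> dom \<psi>" for x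
    using \<psi> that by (auto simp: partial_fun_def)
  have ne: "?L x \<noteq> {}" "?U x \<noteq> {}" if "x \<in> A" for x
    using enc that unfolding encompassing_def by blast+
  have bdd: "bdd_above (?L x)" "bdd_below (?U x)" if x: "x \<in> A" for x
  proof -
    obtain y z where yz: "y \<in> dom \<psi>" "z \<in> dom \<psi>" "y \<le> x" "x \<le> z"
      using enc x unfolding encompassing_def by blast
    show "bdd_above (?L x)"
      by (rule bdd_aboveI[of _ "?v z"]) (use yz in \<open>auto intro!: mono intro: order_trans\<close>)
    show "bdd_below (?U x)"
      by (rule bdd_belowI[of _ "?v y"]) (use yz in \<open>auto intro!: mono intro: order_trans\<close>)
  qed
  have L: "Sup (?L x) = ?v x" "Inf (?U x) = ?v x" if x: "x \<in> dom \<psi>" for x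
  proof -
    show "Sup (?L x) = ?v x"
      by (rule cSup_eq_maximum) (use x in \<open>auto intro!: mono\<close>)
    show "Inf (?U x) = ?v x"
      by (rule cInf_eq_minimum) (use x in \<open>auto intro!: mono\<close>)
  qed
  have monoS: "Sup (?L x) \<le> Sup (?L y)" if "x \<in> A" "y \<in> A" "x \<le> y" for x y
    by (rule cSup_subset_mono) (use that ne bdd in \<open>auto intro: order_trans\<close>)
  have monoI: "Inf (?U x) \<le> Inf (?U y)" if "x \<in> A" "y \<in> A" "x \<le> y" for x y
    by (rule cInf_superset_mono) (use that ne bdd in \<open>auto intro: order_trans\<close>)
  have "is_extension A \<psi> ?l" "is_extension A \<psi> ?u"
    unfolding is_extension_def
    using L sub monoS monoI by (auto intro!: monotone_onI simp: domI)
  moreover have "Sup (?L x) \<le> f x" "f x \<le> Inf (?U x)"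
    if f: "is_extension A \<psi> f" and x: "x \<in> A" for f x
  proof -
    have *: "?v y = f y" if "y \<in> dom \<psi>" for y
      using f that by (simp add: is_extension_def)
    have **: "f y \<le> f z" if "y \<in> A" "z \<in> A" "y \<le> z" for y z
      using f that unfolding is_extension_def by (meson monotone_onD)
    show "Sup (?L x) \<le> f x"
      by (rule cSup_least[OF ne(1)[OF x]]) (elim imageE, simp add: * ** sub x del: domIff)
    show "f x \<le> Inf (?U x)"
      by (rule cInf_greatest[OF ne(2)[OF x]]) (elim imageE, simp add: * ** sub x del: domIff)
  qed
  ultimately show ?thesis
    unfolding extremizable_def is_lower_extension_def is_upper_extension_def
    by (intro conjI exI[of _ ?l] exI[of _ ?u]) auto
qed


section \<open>Order preserving real functions and linearity\<close>

text \<open>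
  A function on the ordered set \<open>X\<close> is represented by its extension by zero to the whole type, so
  that the pointwise order, sum and negation on \<open>'a \<Rightarrow> real\<close> are those of functions on \<open>X\<close>.
\<close>

definition OP :: "'a::order set \<Rightarrow> ('a \<Rightarrow> real) set" where
  "OP X = {f. mono_on X f \<and> (\<forall>x. x \<notin> X \<longrightarrow> f x = 0)}"

definition fscale :: "real \<Rightarrow> ('a \<Rightarrow> real) \<Rightarrow> 'a \<Rightarrow> real" where
  "fscale c f = (\<lambda>x. c * f x)"

interpretation fun_space: vector_space fscale
  by unfold_locales (auto simp: fscale_def fun_eq_iff algebra_simps)

text \<open>
  Unless the order of \<open>X\<close> is trivial, \<open>OP X\<close> is only a convex cone: \<open>- f\<close> need not be order
  preserving. So a linear subspace of \<open>V = OP X\<close> can mean a subset of \<open>V\<close> that is a vector space, or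
  a subset of \<open>V\<close> that is closed under those linear combinations which exist in \<open>V\<close>. The former is
  \<open>fun_space.subspace\<close>, the latter is the next definition; they agree when \<open>V\<close> is a vector space.
\<close>

definition subspace_within :: "('a \<Rightarrow> real) set \<Rightarrow> ('a \<Rightarrow> real) set \<Rightarrow> bool" where
  "subspace_within V S \<longleftrightarrow> S \<subseteq> V \<and> 0 \<in> S \<and>
     (\<forall>f\<in>S. \<forall>g\<in>S. \<forall>a b. fscale a f + fscale b g \<in> V \<longrightarrow> fscale a f + fscale b g \<in> S)"

lemma subspace_within_vector_space:
  assumes V: "fun_space.subspace V"
  shows "subspace_within V S \<longleftrightarrow> S \<subseteq> V \<and> fun_space.subspace S"
proof
  assume S: "subspace_within V S"
  have comb: "fscale a f + fscale b g \<in> S" if "f \<in> S" "g \<in> S" for a b f g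
    using S V that unfolding subspace_within_def
    by (meson fun_space.subspace_add fun_space.subspace_scale subsetD)
  have "fun_space.subspace S"
  proof (rule fun_space.subspaceI)
    show "0 \<in> S"
      using S by (simp add: subspace_within_def)
    show "f + g \<in> S" if "f \<in> S" "g \<in> S" for f g
      using comb[OF that, of 1 1] by simp
    show "fscale c f \<in> S" if "f \<in> S" for c f
      using comb[OF that that, of c 0] by simp
  qed
  then show "S \<subseteq> V \<and> fun_space.subspace S"
    using S by (simp add: subspace_within_def)
next
  assume "S \<subseteq> V \<and> fun_space.subspace S"
  then show "subspace_within V S"
    by (auto simp: subspace_within_def
        intro: fun_space.subspace_0 fun_space.subspace_add fun_space.subspace_scale)
qed

text \<open>Membership of the linear combination in \<open>dom \<psi>\<close> is automatic when \<open>dom \<psi>\<close> is a vector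
  space.\<close>

definition linear_partial :: "(('a \<Rightarrow> real) \<rightharpoonup> real) \<Rightarrow> bool" where
  "linear_partial \<psi> \<longleftrightarrow>
     (\<forall>f\<in>dom \<psi>. \<forall>g\<in>dom \<psi>. \<forall>a b. fscale a f + fscale b g \<in> dom \<psi> \<longrightarrow>
        the (\<psi> (fscale a f + fscale b g)) = a * the (\<psi> f) + b * the (\<psi> g))"

end

theory Submission
  imports Defs
begin

text \<open>
  The upper extension of an extremizable partial function with totally ordered values is its best
  upper approximation from the domain: \<open>uex x < c\<close> exactly when some domain element above \<open>x\<close> has value
  below \<open>c\<close>. If there were none, raising \<open>uex\<close> to at least \<open>c\<close> on everything above \<open>x\<close> would give a
  larger extension. Dually for \<open>lex\<close>. This is \<open>uex_less_iff\<close> and \<open>less_lex_iff\<close>.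

  When the domain is a vector space and \<open>\<psi>\<close> is linear, domain elements above \<open>f\<close> and \<open>g\<close> can be
  scaled and added, and negation exchanges domain elements above \<open>f\<close> with domain elements below
  \<open>- f\<close>. Negation gives \<open>- lex f = uex (- f)\<close>. Scaling by a number of either sign
  (\<open>scaled_above\<close>) and adding gives, whenever \<open>a f + b g\<close> is order preserving,
  \<open>uex (a f + b g) \<le> max (a lex f) (a uex f) + max (b lex g) (b uex g)\<close>
  and the dual bound from below for \<open>lex (a f + b g)\<close>. For non-negative \<open>a\<close> and \<open>b\<close> these bounds are
  the asserted sublinearity of \<open>uex\<close> and superlinearity of \<open>lex\<close>. For \<open>f\<close> and \<open>g\<close> in \<open>Dar \<psi>\<close>, where
  \<open>lex\<close> and \<open>uex\<close> agree, both bounds are \<open>a ex f + b ex g\<close>; so \<open>a f + b g\<close> lies in \<open>Dar \<psi>\<close> and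
  \<open>ex\<close> is linear. Allowing negative coefficients in the bounds matters here: \<open>a f + b g\<close> may be
  order preserving although \<open>b g\<close> is not, and then it cannot be reached by adding within the cone of
  order preserving functions.
\<close>

section \<open>Approximation of the extremal extensions from the domain\<close>

text \<open>
  The strict inequality avoids any infimum or supremum in the value type: it says that \<open>uex x\<close> is the
  greatest lower bound of the values on the domain above \<open>x\<close>, attained or not.
\<close>

lemma uex_less_iff:
  fixes \<psi> :: "'b::order \<rightharpoonup> 'c::linorder"
  assumes ext: "extremizable A \<psi>" and dom: "dom \<psi> \<subseteq> A" and x: "x \<in> A"
  shows "uex_ext A \<psi> x < c \<longleftrightarrow> (\<exists>z\<in>dom \<psi>. x \<le> z \<and> the (\<psi> z) < c)"
proof -
  let ?u = "uex_ext A \<psi>"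
  have u: "is_extension A \<psi> ?u"
    and max: "\<And>f y. is_extension A \<psi> f \<Longrightarrow> y \<in> A \<Longrightarrow> f y \<le> ?u y"
    using extremizableD(2)[OF ext] unfolding is_upper_extension_def by blast+
  have mono: "?u y \<le> ?u z" if "y \<in> A" "z \<in> A" "y \<le> z" for y z
    using u that unfolding is_extension_def by (meson monotone_onD)
  have val: "?u z = the (\<psi> z)" if "z \<in> dom \<psi>" for z
    using u that unfolding is_extension_def by blast
  show ?thesis
  proof
    assume less: "?u x < c"
    show "\<exists>z\<in>dom \<psi>. x \<le> z \<and> the (\<psi> z) < c"
    proof (rule ccontr)
      assume none: "\<not> (\<exists>z\<in>dom \<psi>. x \<le> z \<and> the (\<psi> z) < c)"
      \<comment> \<open>On the domain above \<open>x\<close> all values are at least \<open>c\<close>, so \<open>?f\<close> leaves them unchanged.\<close>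
      let ?f = "restrict (\<lambda>y. if x \<le> y then max c (?u y) else ?u y) A"
      have "is_extension A \<psi> ?f"
        unfolding is_extension_def
      proof (intro conjI ballI)
        show "mono_on A ?f"
        proof (rule monotone_onI)
          fix y z assume "y \<in> A" "z \<in> A" "y \<le> z"
          then show "?f y \<le> ?f z"
            using mono[of y z] by (auto intro: le_max_iff_disj[THEN iffD2] dest: order_trans)
        qed
        show "?f z = the (\<psi> z)" if z: "z \<in> dom \<psi>" for z
          using none z dom val[OF z] by (auto simp: max_def)
      qed simp
      from max[OF this x] show False
        using less x by simp
    qed
  next
    assume "\<exists>z\<in>dom \<psi>. x \<le> z \<and> the (\<psi> z) < c"
    then obtain z where z: "z \<in> dom \<psi>" "x \<le> z" "the (\<psi> z) < c"
      by blast
    then show "?u x < c"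
      using mono[of x z] val[of z] x dom by auto
  qed
qed

lemma less_lex_iff:
  fixes \<psi> :: "'b::order \<rightharpoonup> 'c::linorder"
  assumes ext: "extremizable A \<psi>" and dom: "dom \<psi> \<subseteq> A" and x: "x \<in> A"
  shows "c < lex_ext A \<psi> x \<longleftrightarrow> (\<exists>y\<in>dom \<psi>. y \<le> x \<and> c < the (\<psi> y))"
proof -
  let ?l = "lex_ext A \<psi>"
  have l: "is_extension A \<psi> ?l"
    and min: "\<And>f y. is_extension A \<psi> f \<Longrightarrow> y \<in> A \<Longrightarrow> ?l y \<le> f y"
    using extremizableD(1)[OF ext] unfolding is_lower_extension_def by blast+
  have mono: "?l y \<le> ?l z" if "y \<in> A" "z \<in> A" "y \<le> z" for y z
    using l that unfolding is_extension_def by (meson monotone_onD)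
  have val: "?l y = the (\<psi> y)" if "y \<in> dom \<psi>" for y
    using l that unfolding is_extension_def by blast
  show ?thesis
  proof
    assume less: "c < ?l x"
    show "\<exists>y\<in>dom \<psi>. y \<le> x \<and> c < the (\<psi> y)"
    proof (rule ccontr)
      assume none: "\<not> (\<exists>y\<in>dom \<psi>. y \<le> x \<and> c < the (\<psi> y))"
      let ?f = "restrict (\<lambda>y. if y \<le> x then min c (?l y) else ?l y) A"
      have "is_extension A \<psi> ?f"
        unfolding is_extension_def
      proof (intro conjI ballI)
        show "mono_on A ?f"
        proof (rule monotone_onI)
          fix y z assume "y \<in> A" "z \<in> A" "y \<le> z"
          then show "?f y \<le> ?f z"
            using mono[of y z] by (auto intro: min_le_iff_disj[THEN iffD2] dest: order_trans)
        qed
        show "?f y = the (\<psi> y)" if y: "y \<in> dom \<psi>" for y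
          using none y dom val[OF y] by (auto simp: min_def)
      qed simp
      from min[OF this x] show False
        using less x by simp
    qed
  next
    assume "\<exists>y\<in>dom \<psi>. y \<le> x \<and> c < the (\<psi> y)"
    then obtain y where y: "y \<in> dom \<psi>" "y \<le> x" "c < the (\<psi> y)"
      by blast
    then show "c < ?l x"
      using mono[of y x] val[of y] x dom by auto
  qed
qed

section \<open>Linear partial functions on ordered sets of real functions\<close>

text \<open>
  The ordered set \<open>V\<close> may be any set of real functions, not only the cone of order preserving ones:
  all linear algebra happens in the vector space \<open>dom \<psi>\<close>, which encompasses \<open>V\<close>.
\<close>

locale encompassing_linear =
  fixes V :: "('a \<Rightarrow> real) set" and \<psi> :: "('a \<Rightarrow> real) \<rightharpoonup> real"
  assumes partial: "partial_fun V \<psi>"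
    and encompassing: "encompassing V \<psi>"
    and subspace: "fun_space.subspace (dom \<psi>)"
    and linear: "linear_partial \<psi>"
begin

abbreviation "lex\<^sub>\<psi> \<equiv> lex_ext V \<psi>"
abbreviation "uex\<^sub>\<psi> \<equiv> uex_ext V \<psi>"
abbreviation "val f \<equiv> the (\<psi> f)"

lemma extremizable: "extremizable V \<psi>"
  by (rule encompassing_real_extremizable[OF partial encompassing])

lemma dom_subset: "dom \<psi> \<subseteq> V"
  using partial by (simp add: partial_fun_def)

lemmas uex_less = uex_less_iff[OF extremizable dom_subset]
lemmas less_lex = less_lex_iff[OF extremizable dom_subset]

lemma lex_le_uex: "f \<in> V \<Longrightarrow> lex\<^sub>\<psi> f \<le> uex\<^sub>\<psi> f"
  using extremizableD[OF extremizable]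
  unfolding is_lower_extension_def is_upper_extension_def by blast

lemma dom_subset_Dar: "dom \<psi> \<subseteq> Dar V \<psi>"
  using extremizableD[OF extremizable] dom_subset
  unfolding Dar_def is_lower_extension_def is_upper_extension_def is_extension_def
  by (simp add: subset_iff del: domIff)

lemma val_add:
  assumes "f \<in> dom \<psi>" "g \<in> dom \<psi>"
  shows "val (f + g) = val f + val g"
  using linear[unfolded linear_partial_def, rule_format, OF assms, of 1 1]
    fun_space.subspace_add[OF subspace assms] by simp

lemma val_scale:
  assumes "f \<in> dom \<psi>"
  shows "val (fscale a f) = a * val f"
  using linear[unfolded linear_partial_def, rule_format, OF assms assms, of a 0]
    fun_space.subspace_scale[OF subspace assms] by simp

lemma val_uminus:
  assumes "f \<in> dom \<psi>"
  shows "val (- f) = - val f"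
  using val_scale[OF assms, of "-1"] by simp

lemma uminus_dom: "f \<in> dom \<psi> \<Longrightarrow> - f \<in> dom \<psi>"
  by (rule fun_space.subspace_neg[OF subspace])

lemma uex_uminus:
  assumes f: "f \<in> V" and nf: "- f \<in> V"
  shows "uex\<^sub>\<psi> (- f) = - lex\<^sub>\<psi> f"
proof -
  have "(uex\<^sub>\<psi> (- f) < c) = (- lex\<^sub>\<psi> f < c)" for c
  proof -
    have "uex\<^sub>\<psi> (- f) < c \<longleftrightarrow> (\<exists>z\<in>dom \<psi>. - f \<le> z \<and> val z < c)"
      by (rule uex_less[OF nf])
    also have "\<dots> \<longleftrightarrow> (\<exists>y\<in>dom \<psi>. y \<le> f \<and> - c < val y)"
    proof (intro iffI; elim bexE conjE)
      fix z assume z: "z \<in> dom \<psi>" "- f \<le> z" "val z < c"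
      then have "- z \<le> f"
        by (auto simp: le_fun_def minus_le_iff)
      then show "\<exists>y\<in>dom \<psi>. y \<le> f \<and> - c < val y"
        using z uminus_dom val_uminus by (intro bexI[of _ "- z"]) auto
    next
      fix y assume y: "y \<in> dom \<psi>" "y \<le> f" "- c < val y"
      then have "- f \<le> - y"
        by (auto simp: le_fun_def)
      then show "\<exists>z\<in>dom \<psi>. - f \<le> z \<and> val z < c"
        using y uminus_dom val_uminus by (intro bexI[of _ "- y"]) auto
    qed
    also have "\<dots> \<longleftrightarrow> - c < lex\<^sub>\<psi> f"
      by (rule less_lex[OF f, symmetric])
    finally show ?thesis
      by auto
  qed
  then show ?thesis
    by (metis less_irrefl not_less_iff_gr_or_eq)
qed

text \<open>
  Multiplication by a negative number turns domain elements below \<open>f\<close> into domain elements above the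
  multiple, so \<open>lex\<^sub>\<psi> f\<close> takes over the role of \<open>uex\<^sub>\<psi> f\<close>. As \<open>lex\<^sub>\<psi> f \<le> uex\<^sub>\<psi> f\<close>, the maximum selects
  the right one for either sign. The multiple itself may lie outside \<open>V\<close>.
\<close>

lemma scaled_above:
  assumes f: "f \<in> V" and c: "max (a * lex\<^sub>\<psi> f) (a * uex\<^sub>\<psi> f) < c"
  shows "\<exists>z\<in>dom \<psi>. fscale a f \<le> z \<and> val z < c"
proof -
  consider "a = 0" | "a > 0" | "a < 0"
    by linarith
  then show ?thesis
  proof cases
    case 1
    have "val 0 = 0"
      using val_scale[OF fun_space.subspace_0[OF subspace], of 0] by simp
    then show ?thesis
      using 1 c fun_space.subspace_0[OF subspace] by (intro bexI[of _ 0]) auto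
  next
    case 2
    then have "uex\<^sub>\<psi> f < c / a"
      using c by (simp add: field_simps)
    then obtain z where z: "z \<in> dom \<psi>" "f \<le> z" "val z < c / a"
      using uex_less[OF f] by blast
    then have "fscale a f \<le> fscale a z" "val (fscale a z) < c"
      using 2 val_scale[OF z(1)] by (auto simp: le_fun_def fscale_def field_simps)
    then show ?thesis
      using fun_space.subspace_scale[OF subspace z(1)] by blast
  next
    case 3
    then have "c / a < lex\<^sub>\<psi> f"
      using c by (simp add: field_simps)
    then obtain y where y: "y \<in> dom \<psi>" "y \<le> f" "c / a < val y"
      using less_lex[OF f] by blast
    then have "fscale a f \<le> fscale a y" "val (fscale a y) < c"
      using 3 val_scale[OF y(1)] by (auto simp: le_fun_def fscale_def field_simps)
    then show ?thesis
      using fun_space.subspace_scale[OF subspace y(1)] by blast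
  qed
qed

lemma scaled_below:
  assumes f: "f \<in> V" and c: "c < min (a * lex\<^sub>\<psi> f) (a * uex\<^sub>\<psi> f)"
  shows "\<exists>y\<in>dom \<psi>. y \<le> fscale a f \<and> c < val y"
proof -
  have "max (- a * lex\<^sub>\<psi> f) (- a * uex\<^sub>\<psi> f) < - c"
    using c by auto
  then obtain z where z: "z \<in> dom \<psi>" "fscale (- a) f \<le> z" "val z < - c"
    using scaled_above[OF f] by blast
  then have "- z \<le> fscale a f"
    by (auto simp: le_fun_def fscale_def minus_le_iff)
  then show ?thesis
    using z uminus_dom val_uminus by (intro bexI[of _ "- z"]) auto
qed

text \<open>
  This bound, together with its dual, yields both the sublinearity of \<open>uex\<close> and the linear structure
  of \<open>Dar\<close>: for \<open>a \<ge> 0\<close> the maximum is \<open>a uex f\<close>, and for \<open>f\<close> in \<open>Dar\<close> it is \<open>a ex f\<close> for any \<open>a\<close>.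
\<close>

lemma uex_combination_le:
  assumes f: "f \<in> V" and g: "g \<in> V" and fg: "fscale a f + fscale b g \<in> V"
  shows "uex\<^sub>\<psi> (fscale a f + fscale b g)
    \<le> max (a * lex\<^sub>\<psi> f) (a * uex\<^sub>\<psi> f) + max (b * lex\<^sub>\<psi> g) (b * uex\<^sub>\<psi> g)" (is "_ \<le> ?F + ?G")
proof (rule dense_ge)
  fix c assume "?F + ?G < c"
  \<comment> \<open>Half of the slack goes to each summand.\<close>
  then obtain d where d: "0 < d" "c = ?F + ?G + 2 * d"
    using that[of "(c - ?F - ?G) / 2"] by (simp add: field_simps)
  then have "?F < ?F + d" "?G < ?G + d"
    by simp_all
  then obtain z w where z: "z \<in> dom \<psi>" "fscale a f \<le> z" "val z < ?F + d"
    and w: "w \<in> dom \<psi>" "fscale b g \<le> w" "val w < ?G + d"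
    using scaled_above[OF f] scaled_above[OF g] by meson
  have "fscale a f + fscale b g \<le> z + w"
    using z(2) w(2) by (auto simp: le_fun_def intro: add_mono)
  moreover have "val (z + w) < c"
    using val_add[OF z(1) w(1)] z(3) w(3) d(2) by linarith
  ultimately show "uex\<^sub>\<psi> (fscale a f + fscale b g) \<le> c"
    using uex_less[OF fg] fun_space.subspace_add[OF subspace z(1) w(1)] by (meson less_imp_le)
qed

lemma le_lex_combination:
  assumes f: "f \<in> V" and g: "g \<in> V" and fg: "fscale a f + fscale b g \<in> V"
  shows "min (a * lex\<^sub>\<psi> f) (a * uex\<^sub>\<psi> f) + min (b * lex\<^sub>\<psi> g) (b * uex\<^sub>\<psi> g)
    \<le> lex\<^sub>\<psi> (fscale a f + fscale b g)" (is "?F + ?G \<le> _")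
proof (rule dense_le)
  fix c assume "c < ?F + ?G"
  then obtain d where d: "0 < d" "c = ?F + ?G - 2 * d"
    using that[of "(?F + ?G - c) / 2"] by (simp add: field_simps)
  then have "?F - d < ?F" "?G - d < ?G"
    by linarith+
  then obtain y w where y: "y \<in> dom \<psi>" "y \<le> fscale a f" "?F - d < val y"
    and w: "w \<in> dom \<psi>" "w \<le> fscale b g" "?G - d < val w"
    using scaled_below[OF f] scaled_below[OF g] by meson
  have "y + w \<le> fscale a f + fscale b g"
    using y(2) w(2) by (auto simp: le_fun_def intro: add_mono)
  moreover have "c < val (y + w)"
    using val_add[OF y(1) w(1)] y(3) w(3) d(2) by linarith
  ultimately show "c \<le> lex\<^sub>\<psi> (fscale a f + fscale b g)"
    using less_lex[OF fg] fun_space.subspace_add[OF subspace y(1) w(1)] by (meson less_imp_le)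
qed

lemma uex_sublinear:
  assumes "f \<in> V" "g \<in> V" "fscale a f + fscale b g \<in> V" "0 \<le> a" "0 \<le> b"
  shows "uex\<^sub>\<psi> (fscale a f + fscale b g) \<le> a * uex\<^sub>\<psi> f + b * uex\<^sub>\<psi> g"
  using uex_combination_le[OF assms(1-3)] assms lex_le_uex
  by (simp add: max_absorb2 mult_left_mono)

lemma lex_superlinear:
  assumes "f \<in> V" "g \<in> V" "fscale a f + fscale b g \<in> V" "0 \<le> a" "0 \<le> b"
  shows "a * lex\<^sub>\<psi> f + b * lex\<^sub>\<psi> g \<le> lex\<^sub>\<psi> (fscale a f + fscale b g)"
  using le_lex_combination[OF assms(1-3)] assms lex_le_uex
  by (simp add: min_absorb1 mult_left_mono)

lemma Dar_combination:
  assumes f: "f \<in> Dar V \<psi>" and g: "g \<in> Dar V \<psi>" and fg: "fscale a f + fscale b g \<in> V"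
  shows "fscale a f + fscale b g \<in> Dar V \<psi>"
    and "lex\<^sub>\<psi> (fscale a f + fscale b g) = a * lex\<^sub>\<psi> f + b * lex\<^sub>\<psi> g"
proof -
  have *: "f \<in> V" "g \<in> V" "uex\<^sub>\<psi> f = lex\<^sub>\<psi> f" "uex\<^sub>\<psi> g = lex\<^sub>\<psi> g"
    using f g by (auto simp: Dar_def)
  have "uex\<^sub>\<psi> (fscale a f + fscale b g) \<le> a * lex\<^sub>\<psi> f + b * lex\<^sub>\<psi> g"
    "a * lex\<^sub>\<psi> f + b * lex\<^sub>\<psi> g \<le> lex\<^sub>\<psi> (fscale a f + fscale b g)"
    using uex_combination_le[OF *(1,2) fg] le_lex_combination[OF *(1,2) fg] *(3,4) by simp_all
  with lex_le_uex[OF fg] show "fscale a f + fscale b g \<in> Dar V \<psi>"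
    and "lex\<^sub>\<psi> (fscale a f + fscale b g) = a * lex\<^sub>\<psi> f + b * lex\<^sub>\<psi> g"
    using fg by (auto simp: Dar_def)
qed

lemma subspace_within_Dar: "subspace_within V (Dar V \<psi>)"
  using fun_space.subspace_0[OF subspace] dom_subset_Dar Dar_combination(1)
  unfolding subspace_within_def by (auto simp: Dar_def)

lemma linear_partial_Dar_ext: "linear_partial (Dar_ext V \<psi>)"
  unfolding linear_partial_def dom_Dar_ext
proof (intro ballI allI impI)
  fix f g a b
  assume fg: "f \<in> Dar V \<psi>" "g \<in> Dar V \<psi>" "fscale a f + fscale b g \<in> Dar V \<psi>"
  then have "fscale a f + fscale b g \<in> V"
    by (simp add: Dar_def)
  from Dar_combination(2)[OF fg(1,2) this] fg
  show "the (Dar_ext V \<psi> (fscale a f + fscale b g))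
      = a * the (Dar_ext V \<psi> f) + b * the (Dar_ext V \<psi> g)"
    by (simp add: Dar_ext_def)
qed

end

section \<open>The cone of order preserving functions\<close>

lemma OP_nonneg_combination:
  assumes "f \<in> OP X" "g \<in> OP X" "0 \<le> a" "0 \<le> b"
  shows "fscale a f + fscale b g \<in> OP X"
  using assms unfolding OP_def fscale_def
  by (auto simp: monotone_on_def intro!: add_mono mult_left_mono)

theorem theorem7p10:
  fixes X :: "'a::order set" and \<psi> :: "('a \<Rightarrow> real) \<rightharpoonup> real"
  assumes "partial_fun (OP X) \<psi>"
    and "encompassing (OP X) \<psi>"
    and "fun_space.subspace (dom \<psi>)"
    and "linear_partial \<psi>"
  shows "(\<forall>f1\<in>OP X. \<forall>f2\<in>OP X. \<forall>a1 a2. 0 \<le> a1 \<longrightarrow> 0 \<le> a2 \<longrightarrow>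
            uex_ext (OP X) \<psi> (fscale a1 f1 + fscale a2 f2)
              \<le> a1 * uex_ext (OP X) \<psi> f1 + a2 * uex_ext (OP X) \<psi> f2
          \<and> a1 * lex_ext (OP X) \<psi> f1 + a2 * lex_ext (OP X) \<psi> f2
              \<le> lex_ext (OP X) \<psi> (fscale a1 f1 + fscale a2 f2))
       \<and> (\<forall>f\<in>OP X. - f \<in> OP X \<longrightarrow> - lex_ext (OP X) \<psi> f = uex_ext (OP X) \<psi> (- f))
       \<and> subspace_within (OP X) (Dar (OP X) \<psi>)
       \<and> linear_partial (Dar_ext (OP X) \<psi>)"
proof -
  interpret encompassing_linear "OP X" \<psi>
    using assms by unfold_locales
  show ?thesis
    using uex_sublinear lex_superlinear uex_uminus subspace_within_Dar linear_partial_Dar_ext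
    by (simp add: OP_nonneg_combination)
qed

end
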